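(* Let $K\ge 1$, let $\boldsymbol G_K,\boldsymbol L_K\in\mathbb R^{K\times K}$ satisfy $\boldsymbol L_K=\boldsymbol L_K^{T}\succeq 0$ and $\boldsymbol z^{T}\boldsymbol G_K\boldsymbol z\le 0$ for all $\boldsymbol z\in\mathbb R^K$. Let $\boldsymbol c^n\in\mathbb R^K$ and $r^n\in\mathbb R$ be given, and let $\boldsymbol b^{n+1/2}=\boldsymbol b_K(\overline{\boldsymbol c}^{\,n+1/2})\in\mathbb R^K$ be fixed by explicit extrapolation (so it is a known vector, independent of the unknowns below). Then for every $\Delta t>0$ the fully discrete CARE-SAV scheme $$\frac{\boldsymbol c^{n+1}-\boldsymbol c^n}{\Delta t}=\boldsymbol G_K\boldsymbol d^{n+1/2},$$ $$\boldsymbol d^{n+1/2}=\boldsymbol L_K\frac{\boldsymbol c^{n+1}+\boldsymbol c^n}{2}+\frac{r^{n+1}+r^n}{2}\,\boldsymbol b^{n+1/2},$$ $$\frac{r^{n+1}-r^n}{\Delta t}=\frac12(\boldsymbol b^{n+1/2})^{T}\frac{\boldsymbol c^{n+1}-\boldsymbol c^n}{\Delta t}$$ has a unique solution $(\boldsymbol c^{n+1},\boldsymbol d^{n+1/2},r^{n+1})\in\mathbb R^K\times\mathbb R^K\times\mathbb R$.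
   Context: $\boldsymbol G_K$ and $\boldsymbol L_K$ are the reduced matrices of the mobility operator and of the linear energy operator of a gradient flow $\partial_t\phi=\mathcal G\mu$, $\mu=\mathcal L\phi+\mathcal U(\phi)$, in a $K$-dimensional Galerkin space. The map $\boldsymbol b_K$ takes a coefficient vector in $\mathbb R^K$ to a vector in $\mathbb R^K$ (the projected SAV nonlinearity). The extrapolated coefficient vector is $\overline{\boldsymbol c}^{\,n+1/2}=(3\boldsymbol c^n-\boldsymbol c^{n-1})/2$ for $n\ge1$ and $\overline{\boldsymbol c}^{\,1/2}=\boldsymbol c^0$ for $n=0$; it depends only on already computed data. $\boldsymbol L_K\succeq0$ means positive semidefinite. $\boldsymbol G_K$ is not assumed symmetric. *)

theory Defs
  imports "HOL-Analysis.Analysis"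
begin

definition pos_semidef :: "real ^ 'k ^ 'k \<Rightarrow> bool" where
  "pos_semidef A \<longleftrightarrow> (\<forall>z. 0 \<le> z \<bullet> (A *v z))"

text \<open>Second-order extrapolation of the computed coefficients to the midpoint of time step \<open>n\<close>;
  at the first step only the initial value is available.\<close>

definition extrapolate :: "(nat \<Rightarrow> real ^ 'k) \<Rightarrow> nat \<Rightarrow> real ^ 'k" where
  "extrapolate c n = (if n = 0 then c 0 else (3 *\<^sub>R c n - c (n - 1)) /\<^sub>R 2)"

text \<open>One step of the fully discrete CARE-SAV scheme, with step size \<open>dt\<close>, explicitly known vector
  \<open>b\<close> and current state \<open>(c, r)\<close>; the unknowns are the new coefficients \<open>c'\<close>, the midpoint
  coefficients \<open>d\<close> of the chemical potential and the new auxiliary variable \<open>r'\<close>.\<close>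

definition care_sav_step ::
  "real ^ 'k ^ 'k \<Rightarrow> real ^ 'k ^ 'k \<Rightarrow> real ^ 'k \<Rightarrow> real \<Rightarrow> real ^ 'k \<Rightarrow> real
    \<Rightarrow> real ^ 'k \<Rightarrow> real ^ 'k \<Rightarrow> real \<Rightarrow> bool" where
  "care_sav_step G L b dt c r c' d r' \<longleftrightarrow>
     (c' - c) /\<^sub>R dt = G *v d \<and>
     d = L *v ((c' + c) /\<^sub>R 2) + ((r' + r) / 2) *\<^sub>R b \<and>
     (r' - r) / dt = 1 / 2 * (b \<bullet> ((c' - c) /\<^sub>R dt))"

end

theory Submission
  imports Defs
begin

text \<open>
  Write \<open>v = c' - c\<close> for the increment. The third equation gives \<open>r' = r + (b \<bullet> v) / 2\<close>, and the
  second becomes \<open>d = p + S v\<close> with the known vector \<open>p = L c + r b\<close> and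
  \<open>S v = L v / 2 + (b \<bullet> v) b / 4\<close>. As the first equation says \<open>v = dt G d\<close>, the scheme is
  equivalent to one linear equation \<open>d - dt S (G d) = p\<close> in finite dimension, which is uniquely
  solvable as soon as its homogeneous version has only the zero solution.

  The operator \<open>S\<close> is symmetric and positive semidefinite, as \<open>L\<close> is and the auxiliary variable only
  adds a rank-one square. If \<open>d = dt S (G d)\<close>, then with \<open>w = G d\<close> the number \<open>d \<bullet> G d\<close>
  equals \<open>dt (w \<bullet> S w)\<close>; it is nonpositive by dissipativity of \<open>G\<close> and nonnegative because
  \<open>S\<close> is positive semidefinite. Hence \<open>w \<bullet> S w = 0\<close>, which forces \<open>S w = 0\<close> by symmetry, and so
  \<open>d = dt S w = 0\<close>.
\<close>

text \<open>A nonnegative quadratic form attains its minimum at each of its zeros, so its gradient,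
  which is \<open>2 S x\<close> for symmetric \<open>S\<close>, vanishes there.\<close>

lemma semidefinite_form_zero_imp_kernel:
  fixes S :: "'a::real_inner \<Rightarrow> 'a"
  assumes "linear S"
    and sym: "\<And>x y. x \<bullet> S y = S x \<bullet> y"
    and nonneg: "\<And>x. 0 \<le> x \<bullet> S x"
    and zero: "x \<bullet> S x = 0"
  shows "S x = 0"
proof (rule ccontr)
  assume "S x \<noteq> 0"
  define q where "q = S x \<bullet> S x"
  define a where "a = S x \<bullet> S (S x)"
  have q: "q > 0" using \<open>S x \<noteq> 0\<close> by (simp add: q_def)
  have a: "a \<ge> 0" using nonneg by (simp add: a_def)
  have form: "(x + t *\<^sub>R S x) \<bullet> S (x + t *\<^sub>R S x) = t * (2 * q + t * a)" for t
    using zero sym[of x "S x"]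
    by (simp add: linear_add[OF \<open>linear S\<close>] linear_scale[OF \<open>linear S\<close>] q_def a_def
        inner_simps algebra_simps)
  \<comment> \<open>Descend along \<open>- S x\<close>, with a step short enough that the first-order term dominates.\<close>
  define t where "t = - q / (a + 1)"
  have "t < 0" using q a by (simp add: t_def)
  have "2 * q + t * a = q + q / (a + 1)" using a by (simp add: t_def field_simps)
  moreover have "q + q / (a + 1) > 0" using q a by (simp add: add_pos_nonneg)
  ultimately have "2 * q + t * a > 0" by linarith
  then have "t * (2 * q + t * a) < 0" using \<open>t < 0\<close> by (simp add: mult_neg_pos)
  then show False using form[of t] nonneg[of "x + t *\<^sub>R S x"] by simp
qed

text \<open>The form \<open>d \<bullet> G d\<close> of a kernel element \<open>d\<close> is the \<open>S\<close>-energy of \<open>G d\<close> up to the positive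
  factor \<open>t\<close>, so the opposite signs of the two forms leave only \<open>d = 0\<close>.\<close>

lemma dissipative_semidefinite_resolvent_bij:
  fixes S G :: "'a::euclidean_space \<Rightarrow> 'a"
  assumes S: "linear S" and G: "linear G"
    and sym: "\<And>x y. x \<bullet> S y = S x \<bullet> y"
    and nonneg: "\<And>x. 0 \<le> x \<bullet> S x"
    and dissip: "\<And>z. z \<bullet> G z \<le> 0"
    and "t > 0"
  shows "bij (\<lambda>d. d - t *\<^sub>R S (G d))"
proof -
  let ?T = "\<lambda>d. d - t *\<^sub>R S (G d)"
  have lin: "linear ?T"
    by (rule linearI)
      (simp_all add: linear_add[OF S] linear_add[OF G] linear_scale[OF S] linear_scale[OF G]
        algebra_simps)
  have "d = 0" if "?T d = 0" for d
  proof -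
    have d: "d = t *\<^sub>R S (G d)" using that by simp
    have "d \<bullet> G d = t * (G d \<bullet> S (G d))"
      by (subst d) (simp add: inner_commute)
    then have "t * (G d \<bullet> S (G d)) \<le> 0" using dissip[of d] by simp
    then have "G d \<bullet> S (G d) = 0"
      using nonneg[of "G d"] \<open>t > 0\<close> by (simp add: mult_le_0_iff)
    then have "S (G d) = 0"
      using semidefinite_form_zero_imp_kernel[OF S sym nonneg] by blast
    then show "d = 0" using d by simp
  qed
  then have "inj ?T" using linear_injective_0[OF lin] by blast
  then show ?thesis using linear_injective_imp_surjective[OF lin] by (simp add: bij_def)
qed

text \<open>The map by which the increment of the coefficients enters the midpoint chemical potential
  once the auxiliary variable is eliminated.\<close>

definition sav_operator :: "real ^ 'k ^ 'k \<Rightarrow> real ^ 'k \<Rightarrow> real ^ 'k \<Rightarrow> real ^ 'k" where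
  "sav_operator L b v = (1 / 2) *\<^sub>R (L *v v) + ((b \<bullet> v) / 4) *\<^sub>R b"

lemma linear_sav_operator: "linear (sav_operator L b)"
  by (rule linearI)
    (simp_all add: sav_operator_def matrix_vector_right_distrib inner_simps
      matrix_vector_mult_scaleR algebra_simps add_divide_distrib)

lemma sav_operator_symmetric:
  assumes "transpose L = L"
  shows "x \<bullet> sav_operator L b y = sav_operator L b x \<bullet> y"
proof -
  have "x \<bullet> (L *v y) = (L *v x) \<bullet> y"
    using dot_lmul_matrix[of x L y] assms by (metis transpose_matrix_vector)
  then show ?thesis by (simp add: sav_operator_def inner_simps inner_commute)
qed

lemma sav_operator_nonneg:
  assumes "pos_semidef L"
  shows "0 \<le> v \<bullet> sav_operator L b v"
proof -
  have "v \<bullet> sav_operator L b v = (v \<bullet> (L *v v)) / 2 + (b \<bullet> v)\<^sup>2 / 4"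
    by (simp add: sav_operator_def inner_simps inner_commute power2_eq_square)
  then show ?thesis using assms by (simp add: pos_semidef_def)
qed

text \<open>Eliminating \<open>c'\<close> and \<open>r'\<close> leaves a single linear equation for \<open>d\<close>; conversely, \<open>c'\<close> and \<open>r'\<close>
  are then given explicitly by \<open>d\<close>.\<close>

lemma care_sav_step_iff_reduced:
  assumes "dt > 0"
  shows "care_sav_step G L b dt c r c' d r' \<longleftrightarrow>
    c' = c + dt *\<^sub>R (G *v d) \<and> r' = r + (dt / 2) * (b \<bullet> (G *v d)) \<and>
    d - dt *\<^sub>R sav_operator L b (G *v d) = L *v c + r *\<^sub>R b"
proof -
  have first: "(c' - c) /\<^sub>R dt = G *v d \<longleftrightarrow> c' = c + dt *\<^sub>R (G *v d)"
  proof
    assume "(c' - c) /\<^sub>R dt = G *v d"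
    then have "dt *\<^sub>R (G *v d) = c' - c"
      using assms by (metis scaleR_scaleR right_inverse less_irrefl scaleR_one)
    then show "c' = c + dt *\<^sub>R (G *v d)" by simp
  qed (use assms in simp)
  have third: "(r' - r) / dt = 1 / 2 * (b \<bullet> ((c' - c) /\<^sub>R dt)) \<longleftrightarrow>
      r' = r + (dt / 2) * (b \<bullet> (G *v d))"
    if "(c' - c) /\<^sub>R dt = G *v d"
    unfolding that using assms by (auto simp: field_simps)
  have second: "L *v ((c' + c) /\<^sub>R 2) + ((r' + r) / 2) *\<^sub>R b
      = L *v c + r *\<^sub>R b + dt *\<^sub>R sav_operator L b (G *v d)"
    if "c' = c + dt *\<^sub>R (G *v d)" "r' = r + (dt / 2) * (b \<bullet> (G *v d))"
  proof -
    have "(c' + c) /\<^sub>R 2 = c + (dt / 2) *\<^sub>R (G *v d)"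
      unfolding that by (simp add: vec_eq_iff field_simps)
    then have "L *v ((c' + c) /\<^sub>R 2) = L *v c + (dt / 2) *\<^sub>R (L *v (G *v d))"
      by (simp add: matrix_vector_right_distrib matrix_vector_mult_scaleR)
    moreover have "(r' + r) / 2 = r + dt * ((b \<bullet> (G *v d)) / 4)"
      unfolding that by (simp add: field_simps)
    ultimately show ?thesis
      by (simp only: sav_operator_def) (simp add: scaleR_add_left scaleR_add_right)
  qed
  show ?thesis
    unfolding care_sav_step_def diff_eq_eq[of d] using first second third by metis
qed

theorem theorem1:
  fixes G L :: "real ^ 'k ^ 'k"
    and bK :: "real ^ 'k \<Rightarrow> real ^ 'k"
    and c :: "nat \<Rightarrow> real ^ 'k" and r :: "nat \<Rightarrow> real"
    and n :: nat and dt :: real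
  assumes "transpose L = L" and "pos_semidef L"
    and "\<And>z. z \<bullet> (G *v z) \<le> 0"
    and "dt > 0"
  shows "\<exists>!(s :: (real ^ 'k) \<times> (real ^ 'k) \<times> real). case s of (c', d, r') \<Rightarrow>
           care_sav_step G L (bK (extrapolate c n)) dt (c n) (r n) c' d r'"
proof -
  define b where "b = bK (extrapolate c n)"
  have "bij (\<lambda>d. d - dt *\<^sub>R sav_operator L b (G *v d))"
    using dissipative_semidefinite_resolvent_bij[OF linear_sav_operator
        matrix_vector_mul_linear sav_operator_symmetric sav_operator_nonneg] assms
    by blast
  then have "\<exists>!d. d - dt *\<^sub>R sav_operator L b (G *v d) = L *v c n + r n *\<^sub>R b"
    by (simp add: bij_iff)
  then obtain d where d: "\<And>e. e - dt *\<^sub>R sav_operator L b (G *v e) = L *v c n + r n *\<^sub>R b \<longleftrightarrow> e = d"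
    by metis
  show ?thesis
    unfolding b_def[symmetric]
    by (rule ex1I[of _ "(c n + dt *\<^sub>R (G *v d), d, r n + (dt / 2) * (b \<bullet> (G *v d)))"])
      (auto simp: care_sav_step_iff_reduced[OF \<open>dt > 0\<close>] d)
qed

end
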